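(* Let $n$ and $r$ be positive integers with $n<r$. Then $$|B_u(n,r)|\;\le\;\frac{2\binom{r+2^n-1}{r}}{n!}.$$
   Context: Let $I$ and $O$ be disjoint sets of vertices with $|I|=n$ and $|O|=r$. An $(n,r)$-bipartite graph is a triple $(I,O,E)$ in which each edge in $E$ connects a vertex of $I$ with a vertex of $O$, i.e. $E\subseteq I\times O$ (so there are $2^{nr}$ of them). Two such graphs $(I,O,E_1)$ and $(I,O,E_2)$ are isomorphic if there are bijections $\alpha:I\to I$ and $\beta:O\to O$ such that for all $v_1\in I$, $v_2\in O$: $(\alpha(v_1),\beta(v_2))\in E_2$ if and only if $(v_1,v_2)\in E_1$. $B_u(n,r)$ denotes a set containing exactly one $(n,r)$-bipartite graph from each isomorphism class, so $|B_u(n,r)|$ is the number of isomorphism classes (equivalently, the number of $n\times r$ binary matrices up to row and column permutations). *)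

theory Defs
  imports Complex_Main
begin

text \<open>
  An edge joining \<open>v \<in> I\<close> and \<open>w \<in> J\<close> is encoded as the pair \<open>(v, w)\<close>; the vertex sets are
  fixed, so two graphs differ only in their edge sets. (The letter \<open>J\<close> is used for the second
  vertex class since \<open>O\<close> is the infix notation for relation composition.)
\<close>

type_synonym 'v bipartite = "'v set \<times> 'v set \<times> ('v \<times> 'v) set"

definition bipartite_graphs :: "'v set \<Rightarrow> 'v set \<Rightarrow> 'v bipartite set" where
  "bipartite_graphs I J = {(I, J, E) | E. E \<subseteq> I \<times> J}"

definition bipartite_iso :: "'v set \<Rightarrow> 'v set \<Rightarrow> ('v bipartite \<times> 'v bipartite) set" where
  "bipartite_iso I J =
     {((I, J, E1), (I, J, E2)) | E1 E2. E1 \<subseteq> I \<times> J \<and> E2 \<subseteq> I \<times> J \<and>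
        (\<exists>\<alpha> \<beta>. bij_betw \<alpha> I I \<and> bij_betw \<beta> J J \<and>
           (\<forall>v\<in>I. \<forall>w\<in>J. (\<alpha> v, \<beta> w) \<in> E2 \<longleftrightarrow> (v, w) \<in> E1))}"

text \<open>
  \<open>B\<close> contains exactly one graph from each isomorphism class. Such a \<open>B\<close> is not unique, but
  its cardinality is the number of classes (\<open>card_iso_representatives\<close> below).
\<close>

definition iso_representatives :: "'v set \<Rightarrow> 'v set \<Rightarrow> 'v bipartite set \<Rightarrow> bool" where
  "iso_representatives I J B \<longleftrightarrow>
     B \<subseteq> bipartite_graphs I J \<and>
     (\<forall>C \<in> bipartite_graphs I J // bipartite_iso I J. \<exists>!G. G \<in> B \<and> G \<in> C)"

lemma bipartite_isoI:
  assumes "E1 \<subseteq> I \<times> J" and "E2 \<subseteq> I \<times> J" and "bij_betw \<alpha> I I" and "bij_betw \<beta> J J"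
    and "\<And>v w. v \<in> I \<Longrightarrow> w \<in> J \<Longrightarrow> (\<alpha> v, \<beta> w) \<in> E2 \<longleftrightarrow> (v, w) \<in> E1"
  shows "((I, J, E1), (I, J, E2)) \<in> bipartite_iso I J"
proof -
  have "\<exists>\<alpha> \<beta>. bij_betw \<alpha> I I \<and> bij_betw \<beta> J J \<and>
      (\<forall>v\<in>I. \<forall>w\<in>J. (\<alpha> v, \<beta> w) \<in> E2 \<longleftrightarrow> (v, w) \<in> E1)"
    by (rule exI[of _ \<alpha>], rule exI[of _ \<beta>]) (simp add: assms(3-5))
  then show ?thesis
    using assms(1,2) by (simp add: bipartite_iso_def)
qed

lemma equiv_bipartite_iso: "equiv (bipartite_graphs I J) (bipartite_iso I J)"
proof (rule equivI)
  show "bipartite_iso I J \<subseteq> bipartite_graphs I J \<times> bipartite_graphs I J"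
    unfolding bipartite_iso_def bipartite_graphs_def by blast
  show "refl_on (bipartite_graphs I J) (bipartite_iso I J)"
  proof (rule refl_onI)
    fix G assume "G \<in> bipartite_graphs I J"
    then obtain E where "G = (I, J, E)" "E \<subseteq> I \<times> J"
      unfolding bipartite_graphs_def by blast
    then show "(G, G) \<in> bipartite_iso I J"
      using bipartite_isoI[of E I J E id id] by simp
  qed
  show "sym (bipartite_iso I J)"
  proof (rule symI)
    fix G H assume "(G, H) \<in> bipartite_iso I J"
    then obtain E1 E2 \<alpha> \<beta> where G: "G = (I, J, E1)" "H = (I, J, E2)"
      and E: "E1 \<subseteq> I \<times> J" "E2 \<subseteq> I \<times> J"
      and b: "bij_betw \<alpha> I I" "bij_betw \<beta> J J"
      and e: "\<forall>v\<in>I. \<forall>w\<in>J. (\<alpha> v, \<beta> w) \<in> E2 \<longleftrightarrow> (v, w) \<in> E1"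
      unfolding bipartite_iso_def by blast
    let ?a = "inv_into I \<alpha>" and ?b = "inv_into J \<beta>"
    have b': "bij_betw ?a I I" "bij_betw ?b J J"
      using b by (simp_all add: bij_betw_inv_into)
    have "(?a v, ?b w) \<in> E1 \<longleftrightarrow> (v, w) \<in> E2" if "v \<in> I" "w \<in> J" for v w
    proof -
      have "?a v \<in> I" "?b w \<in> J" using b' that by (simp_all add: bij_betw_apply)
      moreover have "\<alpha> (?a v) = v" "\<beta> (?b w) = w"
        using b that by (simp_all add: bij_betw_inv_into_right)
      ultimately show ?thesis using e by force
    qed
    then show "(H, G) \<in> bipartite_iso I J"
      unfolding G using bipartite_isoI[OF E(2,1) b'] by simp
  qed
  show "trans (bipartite_iso I J)"
  proof (rule transI)
    fix G H K assume "(G, H) \<in> bipartite_iso I J" "(H, K) \<in> bipartite_iso I J"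
    then obtain E1 E2 E3 \<alpha> \<beta> \<alpha>' \<beta>' where G: "G = (I, J, E1)" "K = (I, J, E3)"
      and E: "E1 \<subseteq> I \<times> J" "E3 \<subseteq> I \<times> J"
      and b: "bij_betw \<alpha> I I" "bij_betw \<beta> J J" "bij_betw \<alpha>' I I" "bij_betw \<beta>' J J"
      and e: "\<forall>v\<in>I. \<forall>w\<in>J. (\<alpha> v, \<beta> w) \<in> E2 \<longleftrightarrow> (v, w) \<in> E1"
             "\<forall>v\<in>I. \<forall>w\<in>J. (\<alpha>' v, \<beta>' w) \<in> E3 \<longleftrightarrow> (v, w) \<in> E2"
      unfolding bipartite_iso_def by blast
    note bb = bij_betw_trans[OF b(1,3)] bij_betw_trans[OF b(2,4)]
    have "\<forall>v\<in>I. \<forall>w\<in>J. ((\<alpha>' \<circ> \<alpha>) v, (\<beta>' \<circ> \<beta>) w) \<in> E3 \<longleftrightarrow> (v, w) \<in> E1"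
      using e b by (simp add: bij_betw_apply)
    then show "(G, K) \<in> bipartite_iso I J"
      unfolding G using bipartite_isoI[OF E bb] by simp
  qed
qed

lemma iso_representatives_bij:
  assumes "iso_representatives I J B"
  shows "bij_betw (\<lambda>G. bipartite_iso I J `` {G}) B (bipartite_graphs I J // bipartite_iso I J)"
proof -
  let ?A = "bipartite_graphs I J" and ?r = "bipartite_iso I J"
  have B: "B \<subseteq> ?A" and ex1: "\<And>C. C \<in> ?A // ?r \<Longrightarrow> \<exists>!G. G \<in> B \<and> G \<in> C"
    using assms unfolding iso_representatives_def by blast+
  have self: "G \<in> ?r `` {G}" if "G \<in> B" for G
    using equiv_class_self[OF equiv_bipartite_iso] that B by blast
  have q: "?r `` {G} \<in> ?A // ?r" if "G \<in> B" for G
    using that B by (blast intro: quotientI)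
  show ?thesis
  proof (rule bij_betwI')
    fix G H assume GH: "G \<in> B" "H \<in> B"
    show "(?r `` {G} = ?r `` {H}) = (G = H)"
      using ex1[OF q[OF GH(1)]] self[OF GH(1)] self[OF GH(2)] GH by auto
  next
    fix C assume C: "C \<in> ?A // ?r"
    then obtain G where G: "G \<in> B" "G \<in> C" using ex1 by blast
    obtain K where "K \<in> ?A" "C = ?r `` {K}" using C by (rule quotientE)
    then have "C = ?r `` {G}"
      using G equiv_class_eq[OF equiv_bipartite_iso, of K G] by blast
    then show "\<exists>G\<in>B. C = ?r `` {G}" using G by blast
  qed (rule q)
qed

lemma card_iso_representatives:
  assumes "iso_representatives I J B"
  shows "card B = card (bipartite_graphs I J // bipartite_iso I J)"
  using iso_representatives_bij[OF assms] by (rule bij_betw_same_card)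

lemma iso_representatives_exists: "\<exists>B. iso_representatives I J B"
proof -
  let ?A = "bipartite_graphs I J" and ?r = "bipartite_iso I J"
  define f where "f C = (SOME G. G \<in> C)" for C :: "'a bipartite set"
  have f: "f C \<in> C" if "C \<in> ?A // ?r" for C
    using in_quotient_imp_non_empty[OF equiv_bipartite_iso that]
    unfolding f_def by (simp only: some_in_eq not_False_eq_True)
  have sub: "C \<subseteq> ?A" if "C \<in> ?A // ?r" for C
    using in_quotient_imp_subset[OF equiv_bipartite_iso that] .
  have uniq: "C = D" if "C \<in> ?A // ?r" "D \<in> ?A // ?r" "G \<in> C" "G \<in> D" for C D G
    using quotient_disj[OF equiv_bipartite_iso that(1,2)] that(3,4) by blast
  have "\<exists>!G. G \<in> f ` (?A // ?r) \<and> G \<in> C" if "C \<in> ?A // ?r" for C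
  proof (rule ex1I[of _ "f C"])
    show "f C \<in> f ` (?A // ?r) \<and> f C \<in> C"
      using f[OF that] that by simp
  next
    fix G assume "G \<in> f ` (?A // ?r) \<and> G \<in> C"
    then obtain D where D: "D \<in> ?A // ?r" "G = f D" "G \<in> C" by (auto simp del: split_paired_Ex)
    have "G \<in> D" using f[OF D(1)] unfolding D(2) .
    then show "G = f C" using uniq[OF that D(1) D(3)] D(2) by metis
  qed
  then have ex: "\<forall>C \<in> ?A // ?r. \<exists>!G. G \<in> f ` (?A // ?r) \<and> G \<in> C"
    by (rule ballI)
  have "f ` (?A // ?r) \<subseteq> ?A"
    by (rule image_subsetI) (rule subsetD[OF sub f])
  then have "iso_representatives I J (f ` (?A // ?r))"
    unfolding iso_representatives_def using ex by (rule conjI)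
  then show ?thesis by (rule exI)
qed

end

theory Submission
  imports Defs "HOL-Combinatorics.Permutations" "HOL-Combinatorics.Stirling"
begin

text \<open>
  A graph on fixed vertex classes \<open>I\<close> and \<open>J\<close> is, up to renaming \<open>J\<close>, the multiset of its columns,
  the column of \<open>w \<in> J\<close> being its neighbourhood in \<open>I\<close>. An isomorphism class is then an orbit of the
  permutations of \<open>I\<close> on multisets of size \<open>r\<close> over \<open>Pow I\<close>, a set of \<open>N = 2 ^ n\<close> elements. By
  Burnside's argument \<open>n! * card B\<close> is at most the sum of \<open>F r \<sigma>\<close> over all permutations \<open>\<sigma>\<close>, where
  \<open>F r \<sigma>\<close> is the number of such multisets invariant under \<open>\<sigma>\<close> (\<open>card_representatives_le\<close>). The
  identity contributes exactly \<open>(r + N - 1) choose r\<close>, so what has to be shown is that all other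
  permutations together contribute no more than the identity does.

  Removing an orbit from an invariant multiset, and padding it with copies of the empty column, which
  is always fixed, gives two inequalities for \<open>F\<close>. The first, \<open>inv_count_Suc\<close>, is
  \<open>(r + 1) * F (r + 1) \<sigma> \<le> (N + r) * F r \<sigma>\<close>. It is an equality for the identity, so the ratio of
  \<open>F r \<sigma>\<close> to the contribution of the identity does not increase with \<open>r\<close>, and it suffices to treat
  the smallest value \<open>r = n + 1\<close>. The second, \<open>inv_count_Suc_Suc\<close>, says that
  \<open>(r + 2) * F (r + 2) \<sigma> \<le> x * F (r + 1) \<sigma> + (N + r) * F r \<sigma>\<close>, where \<open>x\<close> is the number of columns
  fixed by \<open>\<sigma>\<close>. Hence \<open>r! * F r \<sigma>\<close> is bounded by a solution \<open>fixed_bound N x r\<close> of a linear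
  recurrence that depends on \<open>\<sigma>\<close> only through \<open>x\<close>.

  A permutation with \<open>c\<close> cycles fixes \<open>2 ^ c\<close> columns, and \<open>stirling n c\<close> permutations have \<open>c\<close>
  cycles (\<open>sum_permutations_invariant_subsets\<close>). This leaves an inequality in \<open>n\<close> alone,
  \<open>stirling_fixed_bound_sum_le\<close>. Small \<open>n\<close> are computed. For \<open>n \<ge> 9\<close> the recurrence shows that a
  permutation with \<open>c = n - m\<close> cycles contributes, relative to the identity, at most
  \<open>\<theta> ^ (n + 1)\<close> with \<open>\<theta> = max ((3/5) ^ m) ((6/7) ^ n)\<close>. The generating function of the Stirling
  numbers turns the powers of \<open>3/5\<close> into a product close to \<open>1\<close>, and the other term is summed over all
  \<open>n!\<close> permutations trivially.
\<close>

section \<open>Multisets invariant under a permutation\<close>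

text \<open>
  For \<open>x = N\<close> this is the rising factorial of \<open>N\<close>. In general \<open>fixed_bound N x r / r!\<close> is the number
  of invariant multisets of size \<open>r\<close> for a permutation of \<open>N\<close> points that has \<open>x\<close> fixed points and
  otherwise only cycles of length two: the coefficient of \<open>t ^ r\<close> in
  \<open>(1 - t) ^ (- x) * (1 - t\<^sup>2) ^ (- (N - x) / 2)\<close>. Clearing the factorial keeps the recurrence
  inside the natural numbers.
\<close>

fun fixed_bound :: "nat \<Rightarrow> nat \<Rightarrow> nat \<Rightarrow> nat" where
  "fixed_bound N x 0 = 1"
| "fixed_bound N x (Suc 0) = x"
| "fixed_bound N x (Suc (Suc r)) = x * fixed_bound N x (Suc r) + Suc r * (N + r) * fixed_bound N x r"

definition invariant_msets :: "'a set \<Rightarrow> ('a \<Rightarrow> 'a) \<Rightarrow> nat \<Rightarrow> 'a multiset set" where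
  "invariant_msets X f r =
     {M. set_mset M \<subseteq> X \<and> size M = r \<and> (\<forall>y\<in>X. count M (f y) = count M y)}"

lemma finite_msets_of_size:
  assumes "finite X"
  shows "finite {M. set_mset M \<subseteq> X \<and> size M = r}"
proof -
  have "{M. set_mset M \<subseteq> X \<and> size M = r} \<subseteq> mset ` {xs. set xs \<subseteq> X \<and> length xs = r}"
  proof
    fix M assume M: "M \<in> {M. set_mset M \<subseteq> X \<and> size M = r}"
    obtain xs where "mset xs = M" using ex_mset by blast
    with M show "M \<in> mset ` {xs. set xs \<subseteq> X \<and> length xs = r}" by force
  qed
  then show ?thesis using finite_lists_length_eq[OF assms] finite_surj by blast
qed

lemma finite_invariant_msets: "finite X \<Longrightarrow> finite (invariant_msets X f r)"
  unfolding invariant_msets_def by (rule finite_subset[OF _ finite_msets_of_size[of X r]]) auto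

text \<open>
  On a finite set that \<open>f\<close> permutes, forward iteration already reaches the whole cycle.
\<close>

definition forward_orbit :: "('a \<Rightarrow> 'a) \<Rightarrow> 'a \<Rightarrow> 'a set" where
  "forward_orbit f y = range (\<lambda>k. (f ^^ k) y)"

lemma self_in_forward_orbit: "y \<in> forward_orbit f y"
  unfolding forward_orbit_def by (rule range_eqI[of _ _ 0]) simp

lemma forward_orbit_closed: "z \<in> forward_orbit f y \<Longrightarrow> f z \<in> forward_orbit f y"
  unfolding forward_orbit_def by clarify (rule range_eqI[of _ _ "Suc k" for k], simp)

lemma forward_orbit_fixed: "f y = y \<Longrightarrow> forward_orbit f y = {y}"
proof -
  assume "f y = y"
  then have "(f ^^ k) y = y" for k by (induction k) auto
  then show ?thesis by (auto simp: forward_orbit_def)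
qed

locale finite_permutation =
  fixes X :: "'a set" and f :: "'a \<Rightarrow> 'a"
  assumes finite: "finite X" and bij: "bij_betw f X X"
begin

abbreviation inv_count :: "nat \<Rightarrow> nat" where
  "inv_count r \<equiv> card (invariant_msets X f r)"

definition occurrences :: "nat \<Rightarrow> 'a \<Rightarrow> nat" where
  "occurrences r y = (\<Sum>M\<in>invariant_msets X f r. count M y)"

lemma sum_occurrences: "(\<Sum>y\<in>X. occurrences r y) = r * inv_count r"
proof -
  have "(\<Sum>y\<in>X. count M y) = r" if "M \<in> invariant_msets X f r" for M
  proof -
    have "(\<Sum>y\<in>X. count M y) = (\<Sum>y\<in>set_mset M. count M y)"
      using that finite by (intro sum.mono_neutral_right) (auto simp: invariant_msets_def not_in_iff)
    then show ?thesis using that by (simp add: invariant_msets_def size_multiset_overloaded_eq)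
  qed
  then show ?thesis
    unfolding occurrences_def by (subst sum.swap) (simp add: mult.commute)
qed

lemma forward_orbit_subset: "y \<in> X \<Longrightarrow> forward_orbit f y \<subseteq> X"
proof -
  assume "y \<in> X"
  then have "(f ^^ k) y \<in> X" for k
    using bij by (induction k) (auto simp: bij_betw_apply)
  then show ?thesis by (auto simp: forward_orbit_def)
qed

lemma finite_forward_orbit: "y \<in> X \<Longrightarrow> finite (forward_orbit f y)"
  using forward_orbit_subset finite finite_subset by blast

lemma forward_orbit_iff:
  assumes "y \<in> X" and "z \<in> X"
  shows "f z \<in> forward_orbit f y \<longleftrightarrow> z \<in> forward_orbit f y"
proof
  let ?O = "forward_orbit f y"
  have "inj_on f ?O"
    using bij forward_orbit_subset[OF assms(1)] by (auto simp: bij_betw_def intro: inj_on_subset)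
  then have "f ` ?O = ?O"
    using finite_forward_orbit[OF assms(1)] forward_orbit_closed
    by (intro endo_inj_surj) auto
  moreover assume "f z \<in> ?O"
  ultimately obtain w where "w \<in> ?O" "f w = f z" by (metis imageE)
  then show "z \<in> ?O"
    using bij assms forward_orbit_subset[OF assms(1)] by (auto simp: bij_betw_def dest: inj_onD)
qed (rule forward_orbit_closed)

text \<open>
  Multiplicities are constant along an orbit, so an invariant multiset containing one point of an orbit
  contains all of it.
\<close>

lemma orbit_subset_mset:
  assumes M: "M \<in> invariant_msets X f r" and y: "y \<in># M"
  shows "mset_set (forward_orbit f y) \<subseteq># M"
proof -
  have yX: "y \<in> X" using M y by (auto simp: invariant_msets_def)
  have X: "(f ^^ k) y \<in> X" for k
    using forward_orbit_subset[OF yX] by (auto simp: forward_orbit_def)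
  have "count M ((f ^^ k) y) = count M y" for k
    using M X by (induction k) (auto simp: invariant_msets_def)
  then have "z \<in># M" if "z \<in> forward_orbit f y" for z
    using that y by (auto simp: forward_orbit_def simp flip: count_greater_zero_iff)
  then have "forward_orbit f y \<subseteq> set_mset M" by blast
  then have "mset_set (forward_orbit f y) \<subseteq># mset_set (set_mset M)"
    by (intro subset_imp_msubset_mset_set) auto
  also have "\<dots> \<subseteq># M" by (rule mset_set_set_mset_msubset)
  finally show ?thesis .
qed

text \<open>
  Deleting one copy of the orbit of \<open>y\<close> from an invariant multiset of size \<open>r + d\<close> and adding copies
  of the fixed point \<open>z\<close> brings the size to exactly \<open>r\<close>. For known \<open>y\<close> the step can be undone, and it
  lowers the multiplicity of \<open>y\<close> by one. The condition for \<open>y = z\<close> prevents the padding from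
  restoring the copies of \<open>y\<close> that were deleted.
\<close>

lemma occurrences_le:
  assumes y: "y \<in> X" and z: "z \<in> X" "f z = z"
    and d: "d \<le> card (forward_orbit f y)" and yz: "y = z \<Longrightarrow> d = 1"
  shows "occurrences (r + d) y \<le> occurrences r y + inv_count r"
proof -
  let ?O = "forward_orbit f y" and ?I = "invariant_msets X f"
  let ?b = "card ?O"
  let ?\<phi> = "\<lambda>M. M - mset_set ?O + replicate_mset (?b - d) z"
  let ?S = "{M \<in> ?I (r + d). y \<in># M}"
  have fin: "finite ?O" by (rule finite_forward_orbit[OF y])
  have sub: "mset_set ?O \<subseteq># M" if "M \<in> ?S" for M
    using that orbit_subset_mset by blast
  have inj: "inj_on ?\<phi> ?S"
  proof (rule inj_onI)
    fix M M' assume S: "M \<in> ?S" "M' \<in> ?S" and "?\<phi> M = ?\<phi> M'"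
    then have "M - mset_set ?O = M' - mset_set ?O" by simp
    then show "M = M'" using sub[OF S(1)] sub[OF S(2)] by (metis subset_mset.diff_add)
  qed
  have maps: "?\<phi> M \<in> ?I r" if M: "M \<in> ?S" for M
  proof -
    have "size (M - mset_set ?O) = r + d - ?b"
      using sub[OF M] M by (simp add: size_Diff_submset invariant_msets_def)
    moreover have "?b \<le> r + d"
      using size_mset_mono[OF sub[OF M]] M by (simp add: invariant_msets_def)
    ultimately have size: "size (?\<phi> M) = r" using d by simp
    have "set_mset (?\<phi> M) \<subseteq> X"
      using M z by (auto simp: invariant_msets_def dest: in_diffD split: if_splits)
    moreover have "count (?\<phi> M) (f v) = count (?\<phi> M) v" if v: "v \<in> X" for v
    proof -
      have "f v = z \<longleftrightarrow> v = z"
        using v z bij by (metis bij_betw_def inj_onD)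
      moreover have "count M (f v) = count M v" using M v by (simp add: invariant_msets_def)
      ultimately show ?thesis
        using forward_orbit_iff[OF y v] fin by (auto simp: count_mset_set')
    qed
    ultimately show ?thesis using size by (simp add: invariant_msets_def)
  qed
  have count: "count M y = count (?\<phi> M) y + 1" if M: "M \<in> ?S" for M
  proof -
    have "y = z \<Longrightarrow> ?b - d = 0" using yz z(2) by (simp add: forward_orbit_fixed)
    then show ?thesis
      using M fin self_in_forward_orbit[of y f] by (auto simp: count_mset_set' simp flip: count_greater_zero_iff)
  qed
  have "occurrences (r + d) y = (\<Sum>M\<in>?S. count M y)"
    unfolding occurrences_def using finite_invariant_msets[OF finite]
    by (intro sum.mono_neutral_right) (auto simp: not_in_iff)
  also have "\<dots> = (\<Sum>M\<in>?S. count (?\<phi> M) y + 1)" by (rule sum.cong[OF refl count])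
  also have "\<dots> = (\<Sum>M\<in>?\<phi> ` ?S. count M y + 1)" by (simp only: sum.reindex[OF inj] o_def)
  also have "\<dots> \<le> (\<Sum>M\<in>?I r. count M y + 1)"
    using maps finite_invariant_msets[OF finite] by (intro sum_mono2) auto
  also have "\<dots> = occurrences r y + inv_count r"
    unfolding occurrences_def by (simp only: sum.distrib) simp
  finally show ?thesis .
qed

lemma card_orbit_ge_1: "y \<in> X \<Longrightarrow> 1 \<le> card (forward_orbit f y)"
  using finite_forward_orbit self_in_forward_orbit by (metis One_nat_def Suc_leI card_gt_0_iff empty_iff)

lemma card_orbit_ge_2:
  assumes "y \<in> X" and "f y \<noteq> y"
  shows "2 \<le> card (forward_orbit f y)"
proof -
  have "{y, f y} \<subseteq> forward_orbit f y"
    using self_in_forward_orbit[of y f] forward_orbit_closed[of y f y] by simp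
  then have "card {y, f y} \<le> card (forward_orbit f y)"
    using finite_forward_orbit[OF assms(1)] card_mono by blast
  then show ?thesis using assms(2) by simp
qed

text \<open>
  Double counting of the occurrences of points in invariant multisets, with every orbit removed in such
  a way that the size drops by one.
\<close>

lemma inv_count_Suc:
  assumes z: "z \<in> X" "f z = z"
  shows "Suc r * inv_count (Suc r) \<le> (card X + r) * inv_count r"
proof -
  have "Suc r * inv_count (Suc r) = (\<Sum>y\<in>X. occurrences (r + 1) y)"
    by (simp add: sum_occurrences)
  also have "\<dots> \<le> (\<Sum>y\<in>X. occurrences r y + inv_count r)"
    using z card_orbit_ge_1 by (intro sum_mono occurrences_le) auto
  also have "\<dots> = (card X + r) * inv_count r"
    by (simp add: sum.distrib sum_occurrences algebra_simps)
  finally show ?thesis .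
qed

text \<open>
  The same double count with the size dropping by two. A moved point has an orbit of at least two
  elements, so one removal suffices; a fixed point is removed twice, and the first of these removals
  accounts for the term with \<open>x\<close>.
\<close>

lemma inv_count_Suc_Suc:
  assumes z: "z \<in> X" "f z = z"
  defines "x \<equiv> card {y \<in> X. f y = y}"
  shows "Suc (Suc r) * inv_count (Suc (Suc r))
       \<le> x * inv_count (Suc r) + (card X + r) * inv_count r"
proof -
  have le: "occurrences (r + 2) y
      \<le> (occurrences r y + inv_count r) + (if f y = y then inv_count (Suc r) else 0)"
    if y: "y \<in> X" for y
  proof (cases "f y = y")
    case True
    have "occurrences (r + 1 + 1) y \<le> occurrences (r + 1) y + inv_count (r + 1)"
      using y z card_orbit_ge_1 by (intro occurrences_le) auto
    moreover have "occurrences (r + 1) y \<le> occurrences r y + inv_count r"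
      using y z card_orbit_ge_1 by (intro occurrences_le) auto
    ultimately show ?thesis using True by simp
  next
    case False
    then show ?thesis
      using y z card_orbit_ge_2[OF y False] occurrences_le[OF y z, of 2 r] by auto
  qed
  have "Suc (Suc r) * inv_count (Suc (Suc r)) = (\<Sum>y\<in>X. occurrences (r + 2) y)"
    by (simp add: sum_occurrences)
  also have "\<dots> \<le> (\<Sum>y\<in>X. (occurrences r y + inv_count r) + (if f y = y then inv_count (Suc r) else 0))"
    by (rule sum_mono[OF le])
  also have "\<dots> = x * inv_count (Suc r) + (card X + r) * inv_count r"
    using finite by (simp add: sum.distrib sum_occurrences algebra_simps x_def sum.inter_filter[symmetric])
  finally show ?thesis .
qed

lemma inv_count_0: "inv_count 0 = 1"
proof -
  have "invariant_msets X f 0 = {{#}}" by (auto simp: invariant_msets_def)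
  then show ?thesis by simp
qed

lemma inv_count_1: "inv_count (Suc 0) \<le> card {y \<in> X. f y = y}"
proof -
  have "invariant_msets X f (Suc 0) \<subseteq> (\<lambda>y. {#y#}) ` {y \<in> X. f y = y}"
  proof
    fix M assume M: "M \<in> invariant_msets X f (Suc 0)"
    then obtain y where [simp]: "M = {#y#}"
      using size_1_singleton_mset[of M] by (auto simp: invariant_msets_def)
    have "y \<in> X" "count {#y#} (f y) = count {#y#} y" using M by (auto simp: invariant_msets_def)
    then show "M \<in> (\<lambda>y. {#y#}) ` {y \<in> X. f y = y}" by (auto split: if_splits)
  qed
  then show ?thesis using finite by (intro surj_card_le) auto
qed

lemma fact_inv_count_le_fixed_bound:
  assumes z: "z \<in> X" "f z = z"
  shows "fact r * inv_count r \<le> fixed_bound (card X) (card {y \<in> X. f y = y}) r"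
proof (induction r rule: less_induct)
  case (less r)
  let ?x = "card {y \<in> X. f y = y}"
  consider "r = 0" | "r = Suc 0" | s where "r = Suc (Suc s)"
    by (metis nat.exhaust)
  then show ?case
  proof cases
    case 3
    have "fact r * inv_count r = fact (Suc s) * (Suc (Suc s) * inv_count (Suc (Suc s)))"
      using 3 by (simp add: algebra_simps)
    also have "\<dots> \<le> fact (Suc s) * (?x * inv_count (Suc s) + (card X + s) * inv_count s)"
      by (intro mult_left_mono inv_count_Suc_Suc[OF z]) simp
    also have "\<dots> = ?x * (fact (Suc s) * inv_count (Suc s)) + Suc s * (card X + s) * (fact s * inv_count s)"
      by (simp add: algebra_simps)
    also have "\<dots> \<le> ?x * fixed_bound (card X) ?x (Suc s) + Suc s * (card X + s) * fixed_bound (card X) ?x s"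
      using 3 by (intro add_mono mult_left_mono less.IH) auto
    finally show ?thesis using 3 by simp
  qed (use inv_count_0 inv_count_1 in simp_all)
qed

text \<open>
  For the identity permutation equality holds; in this sense the ratio between the number of invariant
  multisets and the number of all multisets does not grow with the size.
\<close>

lemma fact_inv_count_le_pochhammer:
  assumes z: "z \<in> X" "f z = z"
  shows "fact (s + k) * inv_count (s + k) \<le> pochhammer (card X + s) k * (fact s * inv_count s)"
proof (induction k)
  case (Suc k)
  have "fact (s + Suc k) * inv_count (s + Suc k) = fact (s + k) * (Suc (s + k) * inv_count (Suc (s + k)))"
    by (simp add: algebra_simps)
  also have "\<dots> \<le> fact (s + k) * ((card X + (s + k)) * inv_count (s + k))"
    by (intro mult_left_mono inv_count_Suc[OF z]) simp
  also have "\<dots> = (card X + s + k) * (fact (s + k) * inv_count (s + k))" by (simp add: algebra_simps)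
  also have "\<dots> \<le> (card X + s + k) * (pochhammer (card X + s) k * (fact s * inv_count s))"
    by (intro mult_left_mono Suc.IH) simp
  finally show ?case by (simp add: pochhammer_Suc mult_ac)
qed simp
end

section \<open>Invariant subsets and Stirling numbers\<close>

lemma image_eq_self_iff:
  assumes "finite T" and "inj \<sigma>" and "T \<subseteq> I"
  shows "\<sigma> ` T = T \<longleftrightarrow> (\<forall>v\<in>I. \<sigma> v \<in> T \<longleftrightarrow> v \<in> T)"
proof
  assume "\<sigma> ` T = T"
  then show "\<forall>v\<in>I. \<sigma> v \<in> T \<longleftrightarrow> v \<in> T" using inj_image_mem_iff[OF assms(2), of _ T] by simp
next
  assume "\<forall>v\<in>I. \<sigma> v \<in> T \<longleftrightarrow> v \<in> T"
  then have "\<sigma> ` T \<subseteq> T" using assms(3) by auto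
  then show "\<sigma> ` T = T" using assms(1,2) by (intro endo_inj_surj) (auto intro: inj_on_subset)
qed

definition invariant_subsets :: "'a set \<Rightarrow> ('a \<Rightarrow> 'a) \<Rightarrow> 'a set set" where
  "invariant_subsets I \<sigma> = {T. T \<subseteq> I \<and> (\<forall>v\<in>I. \<sigma> v \<in> T \<longleftrightarrow> v \<in> T)}"

text \<open>
  A further fixed point of the permutation may be added to an invariant subset or not.
\<close>

lemma card_invariant_subsets_insert:
  assumes S: "finite S" "a \<notin> S" and q: "q permutes S"
  shows "card (invariant_subsets (insert a S) q) = 2 * card (invariant_subsets S q)"
proof -
  let ?K = "invariant_subsets S q"
  have q': "q a = a" "\<And>v. v \<in> S \<Longrightarrow> q v \<in> S"
    using q S(2) by (auto simp: permutes_not_in permutes_in_image)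
  have "T \<in> ?K \<union> insert a ` ?K" if T: "T \<in> invariant_subsets (insert a S) q" for T
  proof (cases "a \<in> T")
    case True
    have "T - {a} \<in> ?K"
      using T S(2) q' by (auto simp: invariant_subsets_def)
    moreover have "T = insert a (T - {a})" using True by auto
    ultimately show ?thesis by blast
  next
    case False
    then show ?thesis using T by (auto simp: invariant_subsets_def)
  qed
  moreover have "T \<in> invariant_subsets (insert a S) q" if "T \<in> ?K" for T
    using that q' S(2) by (auto simp: invariant_subsets_def)
  moreover have "insert a T \<in> invariant_subsets (insert a S) q" if "T \<in> ?K" for T
    using that q' S(2) by (auto simp: invariant_subsets_def)
  ultimately have eq: "invariant_subsets (insert a S) q = ?K \<union> insert a ` ?K" by blast
  have fin: "finite ?K" using S(1) by (auto simp: invariant_subsets_def)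
  have "a \<notin> T" if "T \<in> ?K" for T using that S(2) by (auto simp: invariant_subsets_def)
  then have "?K \<inter> insert a ` ?K = {}" and "inj_on (insert a) ?K"
    by (auto intro!: inj_onI dest: insert_ident)
  then show ?thesis by (simp add: eq card_Un_disjoint fin card_image)
qed

text \<open>
  Composing with the transposition inserts the new point \<open>a\<close> into the cycle of \<open>b\<close>. An invariant
  subset therefore contains \<open>a\<close> exactly if it contains \<open>b\<close>, and is determined by its part in \<open>S\<close>.
\<close>

lemma card_invariant_subsets_transpose:
  assumes S: "finite S" "a \<notin> S" and q: "q permutes S" and b: "b \<in> S"
  shows "card (invariant_subsets (insert a S) (transpose a b \<circ> q)) = card (invariant_subsets S q)"
proof -
  let ?\<sigma> = "transpose a b \<circ> q"
  have q': "q a = a" "\<And>v. v \<in> S \<Longrightarrow> q v \<in> S"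
    using q S(2) by (auto simp: permutes_not_in permutes_in_image)
  have \<sigma>: "?\<sigma> a = b" "\<And>v. v \<in> S \<Longrightarrow> ?\<sigma> v = (if q v = b then a else q v)"
    using q' S(2) b by (auto simp: transpose_def)
  have iff: "T \<in> invariant_subsets (insert a S) ?\<sigma> \<longleftrightarrow>
      T \<subseteq> insert a S \<and> (a \<in> T \<longleftrightarrow> b \<in> T) \<and> T - {a} \<in> invariant_subsets S q" for T
  proof (cases "a \<in> T \<longleftrightarrow> b \<in> T")
    case True
    have "?\<sigma> v \<in> T \<longleftrightarrow> q v \<in> T - {a}" if "v \<in> S" for v
      using \<sigma>(2)[OF that] q'(2)[OF that] True S(2) by auto
    moreover have "v \<in> T \<longleftrightarrow> v \<in> T - {a}" if "v \<in> S" for v using that S(2) by auto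
    ultimately show ?thesis
      using True \<sigma>(1) by (auto simp: invariant_subsets_def simp del: o_apply)
  next
    case False
    then show ?thesis using \<sigma>(1) by (auto simp: invariant_subsets_def simp del: o_apply)
  qed
  have "bij_betw (\<lambda>T. T - {a}) (invariant_subsets (insert a S) ?\<sigma>) (invariant_subsets S q)"
  proof (rule bij_betw_byWitness[where f' = "\<lambda>T. if b \<in> T then insert a T else T"])
    show "\<forall>T\<in>invariant_subsets (insert a S) ?\<sigma>. (if b \<in> T - {a} then insert a (T - {a}) else T - {a}) = T"
      using b S(2) by (auto simp: iff)
    have na: "a \<notin> T" if "T \<in> invariant_subsets S q" for T
      using that S(2) by (auto simp: invariant_subsets_def)
    then show "\<forall>T\<in>invariant_subsets S q. (if b \<in> T then insert a T else T) - {a} = T"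
      by auto
    show "(\<lambda>T. T - {a}) ` invariant_subsets (insert a S) ?\<sigma> \<subseteq> invariant_subsets S q"
      by (auto simp: iff)
    show "(\<lambda>T. if b \<in> T then insert a T else T) ` invariant_subsets S q \<subseteq> invariant_subsets (insert a S) ?\<sigma>"
    proof (rule image_subsetI)
      fix T assume T: "T \<in> invariant_subsets S q"
      then have "T \<subseteq> S" by (auto simp: invariant_subsets_def)
      then show "(if b \<in> T then insert a T else T) \<in> invariant_subsets (insert a S) ?\<sigma>"
        using T na[OF T] b S(2) by (auto simp: iff)
    qed
  qed
  then show ?thesis by (rule bij_betw_same_card)
qed

lemma stirling_sum_Suc:
  fixes g :: "nat \<Rightarrow> 'b::comm_semiring_1"
  shows "(\<Sum>c\<le>Suc n. of_nat (stirling (Suc n) c) * g c)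
       = (\<Sum>c\<le>n. of_nat (stirling n c) * (g (Suc c) + of_nat n * g c))"
proof -
  have "(\<Sum>c\<le>Suc n. of_nat (stirling (Suc n) c) * g c)
      = (\<Sum>c\<le>n. of_nat (stirling (Suc n) (Suc c)) * g (Suc c))"
    by (subst sum.atMost_Suc_shift) simp
  also have "\<dots> = of_nat n * (\<Sum>c\<le>n. of_nat (stirling n (Suc c)) * g (Suc c))
      + (\<Sum>c\<le>n. of_nat (stirling n c) * g (Suc c))"
    by (simp add: algebra_simps sum.distrib sum_distrib_left)
  also have "of_nat n * (\<Sum>c\<le>n. of_nat (stirling n (Suc c)) * g (Suc c))
      = of_nat n * (\<Sum>c\<le>n. of_nat (stirling n c) * g c)"
  proof (cases "n = 0")
    case False
    have "(\<Sum>c\<le>n. of_nat (stirling n c) * g c) = (\<Sum>c\<le>Suc n. of_nat (stirling n c) * g c)"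
      by simp
    also have "\<dots> = (\<Sum>c\<le>n. of_nat (stirling n (Suc c)) * g (Suc c))"
      using False by (subst sum.atMost_Suc_shift) simp
    finally show ?thesis by simp
  qed simp
  finally show ?thesis
    by (simp add: algebra_simps sum.distrib sum_distrib_left)
qed

text \<open>
  A permutation with \<open>c\<close> cycles leaves \<open>2 ^ c\<close> subsets invariant, and \<open>stirling n c\<close> permutations of
  \<open>n\<close> points have \<open>c\<close> cycles. Cycles need not be mentioned: inserting a point either doubles the number
  of invariant subsets (in one way) or keeps it (in \<open>card S\<close> ways), which is the recurrence of the
  Stirling numbers.
\<close>

lemma sum_permutations_invariant_subsets:
  fixes g :: "nat \<Rightarrow> nat"
  assumes "finite I"
  shows "(\<Sum>\<sigma> | \<sigma> permutes I. g (card (invariant_subsets I \<sigma>)))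
       = (\<Sum>c\<le>card I. stirling (card I) c * g (2 ^ c))"
  using assms
proof (induction I arbitrary: g rule: finite_induct)
  case empty
  then show ?case by (simp add: invariant_subsets_def)
next
  case (insert a S)
  let ?inv = "\<lambda>q. card (invariant_subsets S q)"
  have "(\<Sum>\<sigma> | \<sigma> permutes insert a S. g (card (invariant_subsets (insert a S) \<sigma>)))
      = (\<Sum>b\<in>insert a S. \<Sum>q | q permutes S. g (card (invariant_subsets (insert a S) (transpose a b \<circ> q))))"
    by (rule sum_over_permutations_insert[OF insert.hyps])
  also have "\<dots> = (\<Sum>q | q permutes S. g (2 * ?inv q)) + card S * (\<Sum>q | q permutes S. g (?inv q))"
  proof -
    have "(\<Sum>q | q permutes S. g (card (invariant_subsets (insert a S) (transpose a a \<circ> q))))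
        = (\<Sum>q | q permutes S. g (2 * ?inv q))"
      using card_invariant_subsets_insert[OF insert.hyps] by (intro sum.cong) auto
    moreover have "(\<Sum>q | q permutes S. g (card (invariant_subsets (insert a S) (transpose a b \<circ> q))))
        = (\<Sum>q | q permutes S. g (?inv q))" if "b \<in> S" for b
      using card_invariant_subsets_transpose[OF insert.hyps _ that] by (intro sum.cong) auto
    ultimately show ?thesis using insert.hyps by simp
  qed
  also have "\<dots> = (\<Sum>c\<le>card S. stirling (card S) c * (g (2 ^ Suc c) + card S * g (2 ^ c)))"
    using insert.IH[of "\<lambda>x. g (2 * x)"] insert.IH[of g]
    by (simp add: sum.distrib sum_distrib_left algebra_simps)
  also have "\<dots> = (\<Sum>c\<le>card (insert a S). stirling (card (insert a S)) c * g (2 ^ c))"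
    using stirling_sum_Suc[of "card S" "\<lambda>c. g (2 ^ c)"] insert.hyps by simp
  finally show ?case .
qed

section \<open>The numerical inequality\<close>

lemma stirling_power_sum:
  fixes q :: real
  shows "(\<Sum>c\<le>n. real (stirling n c) * q ^ (n - c)) = (\<Prod>k<n. 1 + real k * q)"
proof (induction n)
  case (Suc n)
  have "(\<Sum>c\<le>Suc n. real (stirling (Suc n) c) * q ^ (Suc n - c))
      = (\<Sum>c\<le>n. real (stirling n c) * (q ^ (Suc n - Suc c) + real n * q ^ (Suc n - c)))"
    by (rule stirling_sum_Suc)
  also have "\<dots> = (\<Sum>c\<le>n. real (stirling n c) * q ^ (n - c) * (1 + real n * q))"
    by (rule sum.cong) (auto simp: Suc_diff_le algebra_simps)
  also have "\<dots> = (\<Prod>k<Suc n. 1 + real k * q)"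
    by (simp add: Suc.IH flip: sum_distrib_right)
  finally show ?case .
qed simp

text \<open>
  The recurrence for the ratio of \<open>fixed_bound N x\<close> to the rising factorial of \<open>N\<close> has \<open>\<theta> ^ r\<close> as a
  supersolution as soon as \<open>x / N \<le> \<theta>\<close> and \<open>\<theta>\<^sup>2\<close> dominates \<open>(x / N) * \<theta> + n / N\<close>. In the range
  \<open>r \<le> n + 1\<close> the factor \<open>Suc s\<close> of the recurrence, with \<open>r = s + 2\<close>, is at most \<open>n\<close>.
\<close>

lemma fixed_bound_le_power:
  fixes \<theta> :: real
  assumes \<theta>: "0 \<le> \<theta>" and step: "real x * \<theta> + real n \<le> \<theta>\<^sup>2 * real N"
    and x: "real x \<le> \<theta> * real N" and r: "r \<le> Suc n"
  shows "real (fixed_bound N x r) \<le> \<theta> ^ r * pochhammer (real N) r"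
  using r
proof (induction r rule: less_induct)
  case (less r)
  consider "r = 0" | "r = Suc 0" | s where "r = Suc (Suc s)"
    by (metis nat.exhaust)
  then show ?case
  proof cases
    case 3
    let ?p = "pochhammer (real N)"
    have "real (fixed_bound N x r)
        = real x * real (fixed_bound N x (Suc s)) + real (Suc s) * (real N + real s) * real (fixed_bound N x s)"
      using 3 by (simp add: ring_distribs)
    also have "\<dots> \<le> real x * (\<theta> ^ Suc s * ?p (Suc s)) + real (Suc s) * (real N + real s) * (\<theta> ^ s * ?p s)"
      using less.IH[of "Suc s"] less.IH[of s] less.prems 3 
      by (intro add_mono mult_left_mono) auto
    also have "\<dots> = \<theta> ^ s * ?p (Suc s) * (real x * \<theta> + real (Suc s))"
      by (simp add: pochhammer_Suc ring_distribs mult_ac)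
    also have "\<dots> \<le> \<theta> ^ s * ?p (Suc s) * (\<theta>\<^sup>2 * (real N + real (Suc s)))"
    proof (rule mult_left_mono)
      have "real (Suc s) \<le> real n" using less.prems 3 by simp
      moreover have "0 \<le> \<theta>\<^sup>2 * real (Suc s)" by simp
      ultimately show "real x * \<theta> + real (Suc s) \<le> \<theta>\<^sup>2 * (real N + real (Suc s))"
        using step unfolding distrib_left by linarith
      show "0 \<le> \<theta> ^ s * ?p (Suc s)"
        using \<theta> by (simp add: pochhammer_nonneg pochhammer_prod prod_nonneg)
    qed
    also have "\<dots> = \<theta> ^ r * ?p r"
      using 3 by (simp add: pochhammer_Suc power2_eq_square algebra_simps)
    finally show ?thesis .
  qed (use x in simp_all)
qed

lemma fixed_bound_self: "fixed_bound N N r = pochhammer N r"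
proof (induction r rule: less_induct)
  case (less r)
  consider "r = 0" | "r = Suc 0" | s where "r = Suc (Suc s)"
    by (metis nat.exhaust)
  then show ?case
    by cases (simp_all add: less.IH pochhammer_Suc algebra_simps)
qed

text \<open>
  The next rules, and the one for rising factorials, let the simplifier evaluate both sides of the
  numerical inequality in binary arithmetic for a concrete \<open>n\<close>.
\<close>

lemma stirling_numeral:
  "stirling (numeral a) (numeral b) =
   pred_numeral a * stirling (pred_numeral a) (numeral b) + stirling (pred_numeral a) (pred_numeral b)"
  "stirling (numeral a) (Suc 0) =
   pred_numeral a * stirling (pred_numeral a) (Suc 0) + stirling (pred_numeral a) 0"
  by (simp_all add: numeral_eq_Suc)

lemma fixed_bound_numeral:
  "fixed_bound N x (numeral (num.Bit0 k)) = x * fixed_bound N x (pred_numeral (num.Bit0 k))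
    + pred_numeral (num.Bit0 k) * (N + (pred_numeral (num.Bit0 k) - 1)) * fixed_bound N x (pred_numeral (num.Bit0 k) - 1)"
  "fixed_bound N x (numeral (num.Bit1 k)) = x * fixed_bound N x (pred_numeral (num.Bit1 k))
    + pred_numeral (num.Bit1 k) * (N + (pred_numeral (num.Bit1 k) - 1)) * fixed_bound N x (pred_numeral (num.Bit1 k) - 1)"
proof -
  have *: "fixed_bound N x (Suc m) = x * fixed_bound N x m + m * (N + (m - 1)) * fixed_bound N x (m - 1)" if "m \<noteq> 0" for m
    using that by (cases m) auto
  show "fixed_bound N x (numeral (num.Bit0 k)) = x * fixed_bound N x (pred_numeral (num.Bit0 k))
    + pred_numeral (num.Bit0 k) * (N + (pred_numeral (num.Bit0 k) - 1)) * fixed_bound N x (pred_numeral (num.Bit0 k) - 1)"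
    using *[of "pred_numeral (num.Bit0 k)"] by (simp add: numeral_eq_Suc del: fixed_bound.simps)
  show "fixed_bound N x (numeral (num.Bit1 k)) = x * fixed_bound N x (pred_numeral (num.Bit1 k))
    + pred_numeral (num.Bit1 k) * (N + (pred_numeral (num.Bit1 k) - 1)) * fixed_bound N x (pred_numeral (num.Bit1 k) - 1)"
    using *[of "pred_numeral (num.Bit1 k)"] by (simp add: numeral_eq_Suc del: fixed_bound.simps)
qed

lemma pochhammer_numeral':
  "pochhammer a (numeral k) = a * pochhammer (a + 1) (pred_numeral k)"
  by (simp add: numeral_eq_Suc pochhammer_rec)

lemma stirling_fixed_bound_sum_le_small:
  assumes "n \<in> {1,2,3,4,5,6,7,8}"
  shows "(\<Sum>c\<le>n. stirling n c * fixed_bound (2 ^ n) (2 ^ c) (Suc n)) \<le> 2 * pochhammer (2 ^ n) (Suc n)"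
  using assms
  by (elim insertE emptyE)
     (simp_all add: pochhammer_rec pochhammer_numeral' atMost_nat_numeral stirling_numeral fixed_bound_numeral)

text \<open>
  This bounds the total contribution of the floor \<open>(6/7) ^ n\<close> over all \<open>n!\<close> permutations. From \<open>n\<close> to
  \<open>n + 1\<close> the left-hand side is multiplied by \<open>(n + 1) * (36/49) ^ (n + 1)\<close>, which is below one.
\<close>

lemma fact_mult_power_le: "9 \<le> n \<Longrightarrow> fact n * (6 / 7 :: real) ^ (n * Suc n) \<le> 1 / 2"
proof (induction n rule: dec_induct)
  case base
  show ?case by (simp add: fact_numeral power_divide field_simps)
next
  case (step n)
  have aux: "real (Suc n) * (36 / 49) ^ Suc n \<le> 1" if "9 \<le> n" for n
    using that
  proof (induction n rule: dec_induct)
    case (step n)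
    have "real (Suc (Suc n)) * (36 / 49) ^ Suc (Suc n)
        = (36 / 49 * (real n + 2)) * (36/49) ^ Suc n" by simp
    also have "\<dots> \<le> real (Suc n) * (36 / 49) ^ Suc n"
      using step.hyps by (intro mult_right_mono) auto
    finally show ?case using step.IH by linarith
  qed (simp add: power_divide)
  have "Suc n * Suc (Suc n) = n * Suc n + 2 * Suc n" by simp
  then have "fact (Suc n) * (6 / 7 :: real) ^ (Suc n * Suc (Suc n))
      = (fact n * (6 / 7) ^ (n * Suc n)) * (real (Suc n) * (36 / 49) ^ Suc n)"
    by (simp only: power_add power_mult fact_Suc) (simp add: power2_eq_square)
  also have "\<dots> \<le> 1 / 2 * 1"
    using step by (intro mult_mono aux) auto
  finally show ?case by simp
qed

lemma square_mult_power_le: "9 \<le> n \<Longrightarrow> (real n)\<^sup>2 * (3 / 5) ^ n \<le> 5 / 6"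
proof (induction n rule: dec_induct)
  case (step n)
  have "(real (Suc n))\<^sup>2 * (3 / 5) ^ Suc n = (3 / 5 * (real n + 1)\<^sup>2) * (3 / 5) ^ n"
    by (simp add: add.commute)
  also have "\<dots> \<le> (real n)\<^sup>2 * (3 / 5) ^ n"
  proof (rule mult_right_mono)
    have "9 * real n \<le> real n * real n" using step.hyps by (intro mult_right_mono) auto
    moreover have "(real n + 1)\<^sup>2 = real n * real n + 2 * real n + 1"
      by (simp add: power2_eq_square algebra_simps)
    moreover have "9 \<le> real n" using step.hyps by simp
    ultimately show "3 / 5 * (real n + 1)\<^sup>2 \<le> (real n)\<^sup>2"
      unfolding power2_eq_square by linarith
  qed simp
  finally show ?case using step.IH by linarith
qed (simp add: power_divide)

lemma power_ge_linear: "9 \<le> n \<Longrightarrow> 36 * real n \<le> 11 * (72 / 49) ^ n"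
proof (induction n rule: dec_induct)
  case (step n)
  then have "36 * real (Suc n) \<le> 72 / 49 * (36 * real n)" by simp
  also have "\<dots> \<le> 72 / 49 * (11 * (72 / 49) ^ n)" using step.IH by (intro mult_left_mono) auto
  finally show ?case by simp
qed (simp add: power_divide)

lemma fifty_mult_le: "9 \<le> n \<Longrightarrow> 50 * real n \<le> 3 * 2 ^ n"
  by (induction n rule: dec_induct) auto

text \<open>
  Since \<open>1/2 = (5/6) * (3/5)\<close>, the ratio \<open>2 ^ c / 2 ^ n = (1/2) ^ m\<close>, where \<open>m = n - c\<close>, is at most
  \<open>(5/6) ^ m * \<theta>\<close>, so that a share \<open>1 - (5/6) ^ m\<close> of \<open>\<theta>\<^sup>2\<close> is left to absorb \<open>n / 2 ^ n\<close>. For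
  \<open>m = 1\<close> this share is only \<open>1/6\<close>, but \<open>\<theta> \<ge> 3/5\<close>. For \<open>m \<ge> 2\<close> it is at least \<open>11/36\<close>, and
  \<open>\<theta> \<ge> (6/7) ^ n\<close> suffices: this floor is there because \<open>(3/5) ^ m\<close> alone becomes too small when \<open>m\<close> is
  close to \<open>n\<close>.
\<close>

lemma damping_factor_step:
  assumes n: "9 \<le> n" and c: "c < n"
  defines "\<theta> \<equiv> max ((3 / 5) ^ (n - c)) ((6 / 7) ^ n) :: real"
  shows "real (2 ^ c) * \<theta> + real n \<le> \<theta>\<^sup>2 * real (2 ^ n)"
proof -
  define m where "m = n - c"
  have m: "1 \<le> m" "n = m + c" using c by (simp_all add: m_def)
  have \<theta>: "(3 / 5) ^ m \<le> \<theta>" "(6 / 7) ^ n \<le> \<theta>" by (simp_all add: \<theta>_def m_def)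
  have "0 \<le> \<theta>" using \<theta>(2) zero_le_power[of "6/7::real" n] by linarith
  have "(1 / 2) ^ m = (5 / 6) ^ m * (3 / 5 :: real) ^ m"
    by (simp flip: power_mult_distrib)
  then have half: "(1 / 2) ^ m \<le> (5 / 6) ^ m * \<theta>" using \<theta>(1) by simp
  have "real (2 ^ c) = 2 ^ n * (1 / 2) ^ m"
    by (simp add: m(2) power_add power_divide)
  then have "real (2 ^ c) * \<theta> = 2 ^ n * \<theta> * (1 / 2) ^ m" by simp
  also have "\<dots> \<le> 2 ^ n * \<theta> * ((5 / 6) ^ m * \<theta>)"
    using half \<open>0 \<le> \<theta>\<close> by (intro mult_left_mono) auto
  finally have "real (2 ^ c) * \<theta> \<le> 2 ^ n * \<theta>\<^sup>2 * (5 / 6) ^ m"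
    by (simp add: power2_eq_square mult_ac)
  moreover have "real n \<le> 2 ^ n * \<theta>\<^sup>2 * (1 - (5 / 6) ^ m)"
  proof (cases "m = 1")
    case True
    have "(3 / 5)\<^sup>2 \<le> \<theta>\<^sup>2" using \<theta>(1) True by (intro power_mono) auto
    then have "2 ^ n * (9 / 25) \<le> 2 ^ n * \<theta>\<^sup>2"
      by (intro mult_left_mono) (auto simp: power2_eq_square)
    moreover have "2 ^ n * \<theta>\<^sup>2 * (1 - (5 / 6) ^ m) = 2 ^ n * \<theta>\<^sup>2 / 6" by (simp add: True)
    ultimately show ?thesis using fifty_mult_le[OF n] by linarith
  next
    case False
    have "(5 / 6) ^ m \<le> (5 / 6 :: real) ^ 2"
      using m(1) False by (intro power_decreasing) auto
    then have "11 / 36 \<le> 1 - (5 / 6 :: real) ^ m" by (simp add: power2_eq_square)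
    moreover have "(72 / 49) ^ n \<le> 2 ^ n * \<theta>\<^sup>2"
    proof -
      have "(72 / 49) ^ n = 2 ^ n * ((6 / 7 :: real) ^ n)\<^sup>2"
        by (simp add: power2_eq_square flip: power_mult_distrib)
      also have "\<dots> \<le> 2 ^ n * \<theta>\<^sup>2" using \<theta>(2) by (intro mult_left_mono power_mono) auto
      finally show ?thesis .
    qed
    ultimately have "(72 / 49) ^ n * (11 / 36) \<le> 2 ^ n * \<theta>\<^sup>2 * (1 - (5 / 6) ^ m)"
      by (intro mult_mono) auto
    then show ?thesis using power_ge_linear[OF n] by linarith
  qed
  ultimately show ?thesis by (simp add: algebra_simps)
qed

text \<open>
  The \<open>(n + 1)\<close>-st power of the maximum is bounded by the sum of the two powers, so that the sum over
  \<open>c\<close> splits. For \<open>c = n\<close>, the identity permutation, the first summand is one and there is no damping.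
\<close>

lemma fixed_bound_le_damped:
  assumes n: "9 \<le> n" and c: "c \<le> n"
  shows "real (fixed_bound (2 ^ n) (2 ^ c) (Suc n))
    \<le> pochhammer (2 ^ n) (Suc n) * (((3 / 5) ^ Suc n) ^ (n - c) + (6 / 7) ^ (n * Suc n))"
proof (cases "c = n")
  case True
  have "real (fixed_bound (2 ^ n) (2 ^ c) (Suc n)) = pochhammer (2 ^ n) (Suc n) * 1"
    using True pochhammer_of_nat[of "2 ^ n" "Suc n", where 'a = real] by (simp add: fixed_bound_self)
  also have "\<dots> \<le> pochhammer (2 ^ n) (Suc n) * (((3 / 5) ^ Suc n) ^ (n - c) + (6 / 7) ^ (n * Suc n))"
    using True by (intro mult_left_mono) (simp_all add: pochhammer_nonneg)
  finally show ?thesis .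
next
  case False
  define \<theta> :: real where "\<theta> = max ((3 / 5) ^ (n - c)) ((6 / 7) ^ n)"
  have step: "real (2 ^ c) * \<theta> + real n \<le> \<theta>\<^sup>2 * real (2 ^ n)"
    unfolding \<theta>_def using damping_factor_step[OF n, of c] c False by simp
  have "2 ^ c = (1 / 2) ^ (n - c) * (2 ^ n :: real)"
    using c by (simp add: power_divide field_simps flip: power_add)
  also have "(1 / 2) ^ (n - c) \<le> (3 / 5 :: real) ^ (n - c)" by (intro power_mono) auto
  also have "\<dots> \<le> \<theta>" by (simp add: \<theta>_def)
  finally have x: "real (2 ^ c) \<le> \<theta> * real (2 ^ n)" by simp
  have "0 \<le> \<theta>" by (simp add: \<theta>_def le_max_iff_disj)
  from fixed_bound_le_power[OF this step x order_refl]
  have "real (fixed_bound (2 ^ n) (2 ^ c) (Suc n)) \<le> pochhammer (2 ^ n) (Suc n) * \<theta> ^ Suc n"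
    by (simp add: mult.commute)
  also have "\<theta> ^ Suc n \<le> ((3 / 5) ^ (n - c)) ^ Suc n + ((6 / 7) ^ n) ^ Suc n"
    by (cases "(3 / 5) ^ (n - c) \<le> ((6 / 7) ^ n :: real)")
       (simp_all add: \<theta>_def max_def del: power_Suc)
  also have "\<dots> = ((3 / 5) ^ Suc n) ^ (n - c) + (6 / 7) ^ (n * Suc n)"
    by (simp only: power_mult[symmetric] mult.commute)
  finally show ?thesis
    by (simp add: mult_left_mono pochhammer_nonneg)
qed

text \<open>
  The product is at most the exponential of \<open>n\<^sup>2 / 2 * (3/5) ^ (n + 1)\<close>, which is at most \<open>exp (1/4)\<close>.
\<close>

lemma prod_one_plus_le:
  assumes n: "9 \<le> n"
  shows "(\<Prod>k<n. 1 + real k * (3 / 5) ^ Suc n) \<le> 3 / 2"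
proof -
  have "(\<Prod>k<n. 1 + real k * (3 / 5) ^ Suc n) \<le> (\<Prod>k<n. exp (real k * (3 / 5) ^ Suc n))"
    by (intro prod_mono) auto
  also have "\<dots> = exp ((\<Sum>k<n. real k) * (3 / 5) ^ Suc n)"
    by (simp add: exp_sum sum_distrib_right del: power_Suc)
  also have "(\<Sum>k<n. real k) \<le> (real n)\<^sup>2 / 2"
    by (induction n) (auto simp: power2_eq_square field_simps)
  also have "(real n)\<^sup>2 / 2 * (3 / 5) ^ Suc n \<le> 1 / 4"
    using square_mult_power_le[OF n] by simp
  also have "exp (1 / 4 :: real) \<le> 3 / 2"
    using exp_bound[of "1 / 4"] by (simp add: power2_eq_square)
  finally show ?thesis by simp
qed

lemma stirling_fixed_bound_sum_le_large:
  assumes n: "9 \<le> n"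
  shows "(\<Sum>c\<le>n. stirling n c * fixed_bound (2 ^ n) (2 ^ c) (Suc n)) \<le> 2 * pochhammer (2 ^ n) (Suc n)"
proof -
  let ?P = "pochhammer (2 ^ n) (Suc n) :: real"
  have "real (\<Sum>c\<le>n. stirling n c * fixed_bound (2 ^ n) (2 ^ c) (Suc n))
      \<le> (\<Sum>c\<le>n. real (stirling n c) * (?P * (((3 / 5) ^ Suc n) ^ (n - c) + (6 / 7) ^ (n * Suc n))))"
    unfolding of_nat_sum of_nat_mult
    by (intro sum_mono mult_left_mono fixed_bound_le_damped n) auto
  also have "\<dots> = ?P * ((\<Sum>c\<le>n. real (stirling n c) * ((3 / 5) ^ Suc n) ^ (n - c))
      + real (\<Sum>c\<le>n. stirling n c) * (6 / 7) ^ (n * Suc n))"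
    unfolding of_nat_sum sum_distrib_left sum_distrib_right sum.distrib[symmetric]
    by (intro sum.cong refl) (simp add: algebra_simps)
  also have "\<dots> = ?P * ((\<Prod>k<n. 1 + real k * (3 / 5) ^ Suc n) + fact n * (6 / 7) ^ (n * Suc n))"
    by (simp only: stirling_power_sum sum_stirling of_nat_fact)
  also have "\<dots> \<le> ?P * (3 / 2 + 1 / 2)"
    by (intro mult_left_mono add_mono prod_one_plus_le fact_mult_power_le n) (simp_all add: pochhammer_nonneg)
  also have "\<dots> = real (2 * pochhammer (2 ^ n) (Suc n))"
    using pochhammer_of_nat[of "2 ^ n" "Suc n", where 'a = real] by simp
  finally show ?thesis by (simp only: of_nat_le_iff)
qed

lemma stirling_fixed_bound_sum_le:
  assumes "0 < n"
  shows "(\<Sum>c\<le>n. stirling n c * fixed_bound (2 ^ n) (2 ^ c) (Suc n)) \<le> 2 * pochhammer (2 ^ n) (Suc n)"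
proof -
  have "n \<in> {1,2,3,4,5,6,7,8} \<or> 9 \<le> n" using assms by auto
  then show ?thesis using stirling_fixed_bound_sum_le_small stirling_fixed_bound_sum_le_large by blast
qed

section \<open>Graphs as multisets of columns\<close>

text \<open>
  One half of Burnside's lemma, for a set \<open>T\<close> of pairwise inequivalent points. Choose for each \<open>t \<in> T\<close>
  and each \<open>y\<close> in its orbit a permutation \<open>k t y\<close> taking \<open>t\<close> to \<open>y\<close>. Then \<open>(\<sigma>, t)\<close> is sent to the
  point \<open>y = \<sigma> t\<close> together with the permutation \<open>\<sigma> \<circ> inv (k t y)\<close>, which fixes \<open>y\<close>. This is
  injective: \<open>y\<close> determines \<open>t\<close> by inequivalence, hence also \<open>k t y\<close> and finally \<open>\<sigma>\<close>.
\<close>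

lemma burnside_le:
  assumes I: "finite I" and \<Omega>: "finite \<Omega>"
    and closed: "\<And>\<sigma> y. \<sigma> permutes I \<Longrightarrow> y \<in> \<Omega> \<Longrightarrow> act \<sigma> y \<in> \<Omega>"
    and act_id: "\<And>y. act id y = y"
    and act_comp: "\<And>\<sigma> \<tau> y. act (\<sigma> \<circ> \<tau>) y = act \<sigma> (act \<tau> y)"
    and T: "T \<subseteq> \<Omega>"
    and ineq: "\<And>\<sigma> t u. \<sigma> permutes I \<Longrightarrow> t \<in> T \<Longrightarrow> u \<in> T \<Longrightarrow> act \<sigma> t = u \<Longrightarrow> t = u"
  shows "fact (card I) * card T \<le> (\<Sum>\<sigma> | \<sigma> permutes I. card {y \<in> \<Omega>. act \<sigma> y = y})"
proof -
  let ?P = "{\<sigma>. \<sigma> permutes I}"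
  define k where "k t y = (SOME \<tau>. \<tau> permutes I \<and> act \<tau> t = y)" for t y
  have k: "k t (act \<sigma> t) permutes I \<and> act (k t (act \<sigma> t)) t = act \<sigma> t" if "\<sigma> permutes I" for \<sigma> t
    unfolding k_def by (rule someI[of _ \<sigma>]) (simp add: that)
  define \<psi> where "\<psi> = (\<lambda>(\<sigma>, t). (\<sigma> \<circ> inv (k t (act \<sigma> t)), act \<sigma> t))"
  have same: "\<sigma> = \<sigma>' \<and> t = t'"
    if \<sigma>: "\<sigma> permutes I" "\<sigma>' permutes I" and t: "t \<in> T" "t' \<in> T"
      and eq: "\<sigma> \<circ> inv (k t (act \<sigma> t)) = \<sigma>' \<circ> inv (k t' (act \<sigma>' t'))"
      and y: "act \<sigma> t = act \<sigma>' t'" for \<sigma> \<sigma>' t t'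
  proof -
    have "act (inv \<sigma>' \<circ> \<sigma>) t = act (inv \<sigma>' \<circ> \<sigma>') t'"
      using y by (simp add: act_comp)
    also have "\<dots> = t'" using \<sigma>(2) by (simp add: act_id permutes_inv_o(2))
    finally have "t' = t"
      using ineq[of "inv \<sigma>' \<circ> \<sigma>" t t'] t \<sigma> by (simp add: permutes_compose permutes_inv)
    then have "\<sigma> \<circ> inv (k t (act \<sigma> t)) \<circ> k t (act \<sigma> t) = \<sigma>' \<circ> inv (k t (act \<sigma> t)) \<circ> k t (act \<sigma> t)"
      using eq y by simp
    then show ?thesis
      using permutes_inv_o(2)[of "k t (act \<sigma> t)" I] k[OF \<sigma>(1), of t] \<open>t' = t\<close>
      by (simp add: o_assoc[symmetric])
  qed
  have "inj_on \<psi> (?P \<times> T)"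
    by (rule inj_onI) (use same in \<open>auto simp: \<psi>_def simp del: o_apply\<close>)
  moreover have "\<psi> ` (?P \<times> T) \<subseteq> (SIGMA \<sigma>:?P. {y \<in> \<Omega>. act \<sigma> y = y})"
  proof (clarsimp simp: \<psi>_def, intro conjI)
    fix \<sigma> t assume \<sigma>: "\<sigma> permutes I" and t: "t \<in> T"
    let ?k = "k t (act \<sigma> t)"
    show "\<sigma> \<circ> inv ?k permutes I" using k[OF \<sigma>] \<sigma> by (simp add: permutes_compose permutes_inv)
    show "act \<sigma> t \<in> \<Omega>" using closed \<sigma> t T by blast
    have "act (inv ?k) (act \<sigma> t) = act (inv ?k) (act ?k t)" using k[OF \<sigma>] by simp
    also have "\<dots> = t"
      by (simp only: act_comp[symmetric] permutes_inv_o(2)[OF conjunct1[OF k[OF \<sigma>]]] act_id)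
    finally show "act (\<sigma> \<circ> inv ?k) (act \<sigma> t) = act \<sigma> t" by (simp add: act_comp)
  qed
  ultimately have "card (?P \<times> T) \<le> card (SIGMA \<sigma>:?P. {y \<in> \<Omega>. act \<sigma> y = y})"
    using I \<Omega> by (intro card_inj_on_le[of \<psi>]) (auto simp: finite_permutations)
  then show ?thesis
    using I \<Omega> by (simp add: card_cartesian_product card_permutations[OF refl I] card_SigmaI finite_permutations)
qed

definition columns :: "'v set \<Rightarrow> ('v \<times> 'v) set \<Rightarrow> 'v set multiset" where
  "columns J E = image_mset (\<lambda>w. {v. (v, w) \<in> E}) (mset_set J)"

text \<open>
  Equality of the two multisets provides the bijection of \<open>J\<close> that matches equal columns.
\<close>

lemma columns_eq_imp_iso:
  assumes "finite J" and E: "E1 \<subseteq> I \<times> J" "E2 \<subseteq> I \<times> J" and \<sigma>: "\<sigma> permutes I"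
    and eq: "image_mset (image \<sigma>) (columns J E1) = columns J E2"
  shows "((I, J, E1), (I, J, E2)) \<in> bipartite_iso I J"
proof -
  have "image_mset (\<lambda>w. \<sigma> ` {v. (v, w) \<in> E1}) (mset_set J) = image_mset (\<lambda>w. {v. (v, w) \<in> E2}) (mset_set J)"
    using eq by (simp add: columns_def multiset.map_comp o_def)
  from image_mset_eq_implies_permutes[OF assms(1) this]
  obtain p where p: "p permutes J" "\<forall>w\<in>J. \<sigma> ` {v. (v, w) \<in> E1} = {v. (v, p w) \<in> E2}" .
  show ?thesis
  proof (rule bipartite_isoI[OF E])
    show "bij_betw \<sigma> I I" "bij_betw p J J" using \<sigma> p(1) by (simp_all add: permutes_imp_bij)
    fix v w assume "v \<in> I" "w \<in> J"
    have "(\<sigma> v, p w) \<in> E2 \<longleftrightarrow> \<sigma> v \<in> \<sigma> ` {v. (v, w) \<in> E1}" using p(2) \<open>w \<in> J\<close> by simp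
    also have "\<dots> \<longleftrightarrow> (v, w) \<in> E1"
      using inj_image_mem_iff[OF permutes_inj[OF \<sigma>], of v "{v. (v, w) \<in> E1}"] by simp
    finally show "(\<sigma> v, p w) \<in> E2 \<longleftrightarrow> (v, w) \<in> E1" .
  qed
qed

text \<open>
  The column multisets of the representatives are pairwise inequivalent under permutations of \<open>I\<close>, by
  \<open>columns_eq_imp_iso\<close>, so Burnside's inequality applies to them.
\<close>

lemma card_representatives_le:
  assumes I: "finite I" and J: "finite J" and B: "iso_representatives I J B"
  shows "fact (card I) * card B
    \<le> (\<Sum>\<sigma> | \<sigma> permutes I. card (invariant_msets (Pow I) (image \<sigma>) (card J)))"
proof -
  let ?\<Omega> = "{M. set_mset M \<subseteq> Pow I \<and> size M = card J}"
  define col where "col = (\<lambda>G :: 'a bipartite. columns J (snd (snd G)))"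
  have B_edges: "\<exists>E. G = (I, J, E) \<and> E \<subseteq> I \<times> J" if "G \<in> B" for G
    using B that unfolding iso_representatives_def bipartite_graphs_def by blast
  have uniq: "G = H" if "G \<in> B" "H \<in> B" "(G, H) \<in> bipartite_iso I J" for G H
    using iso_representatives_bij[OF B] equiv_class_eq[OF equiv_bipartite_iso that(3)] that(1,2)
    by (auto simp: bij_betw_def dest: inj_onD)
  have same: "G = H" if GH: "G \<in> B" "H \<in> B" and \<sigma>: "\<sigma> permutes I"
    and eq: "image_mset (image \<sigma>) (col G) = col H" for G H \<sigma>
  proof -
    obtain E1 E2 where "G = (I, J, E1)" "H = (I, J, E2)" "E1 \<subseteq> I \<times> J" "E2 \<subseteq> I \<times> J"
      using B_edges GH by meson
    then show ?thesis using uniq[OF GH] columns_eq_imp_iso[OF J _ _ \<sigma>] eq by (simp add: col_def)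
  qed
  have "inj_on col B"
    by (rule inj_onI) (rule same[OF _ _ permutes_id], auto)
  then have "card B = card (col ` B)" by (simp add: card_image)
  also have "fact (card I) * card (col ` B)
      \<le> (\<Sum>\<sigma> | \<sigma> permutes I. card {M \<in> ?\<Omega>. image_mset (image \<sigma>) M = M})"
  proof (rule burnside_le[OF I])
    show "finite ?\<Omega>" using I by (intro finite_msets_of_size) simp
    show "image_mset (image \<sigma>) M \<in> ?\<Omega>" if "\<sigma> permutes I" "M \<in> ?\<Omega>" for \<sigma> M
      using that permutes_image[OF that(1)] by fastforce
    show "image_mset (image id) M = M" for M :: "'a set multiset" by simp
    show "image_mset (image (\<sigma> \<circ> \<tau>)) M = image_mset (image \<sigma>) (image_mset (image \<tau>) M)"
      for \<sigma> \<tau> :: "'a \<Rightarrow> 'a" and M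
      by (simp add: multiset.map_comp o_def image_image)
    show "(col ` B) \<subseteq> ?\<Omega>"
      using B_edges J unfolding col_def columns_def by fastforce
    show "t = u" if "\<sigma> permutes I" "t \<in> (col ` B)" "u \<in> (col ` B)" "image_mset (image \<sigma>) t = u" for \<sigma> t u
    proof -
      obtain G H where "G \<in> B" "H \<in> B" "t = col G" "u = col H" using \<open>t \<in> _\<close> \<open>u \<in> _\<close> by blast
      then show ?thesis using same[of G H \<sigma>] that by simp
    qed
  qed
  also have "\<dots> \<le> (\<Sum>\<sigma> | \<sigma> permutes I. card (invariant_msets (Pow I) (image \<sigma>) (card J)))"
  proof (rule sum_mono, rule card_mono)
    fix \<sigma> assume "\<sigma> \<in> {\<sigma>. \<sigma> permutes I}"
    then have "inj (image \<sigma>)" by (intro injI) (simp add: permutes_inj inj_image_eq_iff)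
    then have "count (image_mset (image \<sigma>) M) (\<sigma> ` y) = count M y" for M y
      by (induction M) (auto simp: inj_eq)
    then have "count M (\<sigma> ` y) = count M y" if "image_mset (image \<sigma>) M = M" for M y
      by (metis that)
    then show "{M \<in> ?\<Omega>. image_mset (image \<sigma>) M = M} \<subseteq> invariant_msets (Pow I) (image \<sigma>) (card J)"
      by (auto simp: invariant_msets_def)
  qed (use I in \<open>simp add: finite_invariant_msets\<close>)
  finally show ?thesis .
qed

section \<open>The bound on the number of isomorphism classes\<close>

lemma pochhammer_eq_fact_binomial:
  "pochhammer (Suc m) r = fact r * ((r + m) choose r)"
proof (induction r)
  case (Suc r)
  have "pochhammer (Suc m) (Suc r) = fact r * (Suc (r + m) * ((r + m) choose r))"
    by (simp add: pochhammer_Suc Suc.IH algebra_simps)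
  also have "\<dots> = fact (Suc r) * ((Suc r + m) choose Suc r)"
    by (subst Suc_times_binomial_eq) (simp add: algebra_simps)
  finally show ?case .
qed simp

theorem theorem4:
  fixes n r :: nat and I J :: "'v set" and B :: "'v bipartite set"
  assumes "0 < n" and "0 < r" and "n < r"
    and "finite I" and "finite J" and "I \<inter> J = {}"
    and "card I = n" and "card J = r"
    and "iso_representatives I J B"
  shows "real (card B) \<le> 2 * real ((r + 2 ^ n - 1) choose r) / fact n"
proof -
  define N :: nat where "N = 2 ^ n"
  \<comment> \<open>The number of steps by which \<open>r\<close> exceeds its least possible value \<open>n + 1\<close>.\<close>
  define k where "k = r - Suc n"
  have r: "r = Suc n + k" using \<open>n < r\<close> by (simp add: k_def)
  have each: "fact r * card (invariant_msets (Pow I) (image \<sigma>) r)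
      \<le> pochhammer (N + Suc n) k * fixed_bound N (card (invariant_subsets I \<sigma>)) (Suc n)"
    if \<sigma>: "\<sigma> permutes I" for \<sigma>
  proof -
    interpret finite_permutation "Pow I" "image \<sigma>"
      by unfold_locales (use \<open>finite I\<close> \<sigma> in \<open>auto intro: bij_betw_Pow permutes_imp_bij\<close>)
    have "{T \<in> Pow I. \<sigma> ` T = T} = invariant_subsets I \<sigma>"
      using image_eq_self_iff[of _ \<sigma> I] \<open>finite I\<close> permutes_inj[OF \<sigma>] permutes_image[OF \<sigma>]
      by (auto simp: invariant_subsets_def finite_subset)
    then have "fact (Suc n) * inv_count (Suc n) \<le> fixed_bound N (card (invariant_subsets I \<sigma>)) (Suc n)"
      using fact_inv_count_le_fixed_bound[of "{}" "Suc n"] assms by (simp add: card_Pow N_def)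
    then have a: "pochhammer (N + Suc n) k * (fact (Suc n) * inv_count (Suc n))
        \<le> pochhammer (N + Suc n) k * fixed_bound N (card (invariant_subsets I \<sigma>)) (Suc n)"
      by (rule mult_left_mono) simp
    \<comment> \<open>The empty column is the fixed point needed for padding.\<close>
    have b: "fact (Suc n + k) * inv_count (Suc n + k)
        \<le> pochhammer (card (Pow I) + Suc n) k * (fact (Suc n) * inv_count (Suc n))"
      by (rule fact_inv_count_le_pochhammer[of "{}"]) auto
    have c: "card (Pow I) = N" using assms by (simp add: card_Pow N_def)
    show ?thesis unfolding r by (rule order_trans[OF b[unfolded c] a])
  qed
  have "fact r * (fact n * card B)
      \<le> (\<Sum>\<sigma> | \<sigma> permutes I. fact r * card (invariant_msets (Pow I) (image \<sigma>) r))"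
    using mult_left_mono[OF card_representatives_le[of I J B], of "fact r"] assms
    by (simp add: sum_distrib_left)
  also have "\<dots> \<le> (\<Sum>\<sigma> | \<sigma> permutes I. pochhammer (N + Suc n) k * fixed_bound N (card (invariant_subsets I \<sigma>)) (Suc n))"
    using each by (intro sum_mono) simp
  also have "\<dots> = pochhammer (N + Suc n) k * (\<Sum>c\<le>n. stirling n c * fixed_bound N (2 ^ c) (Suc n))"
    using sum_permutations_invariant_subsets[of I "\<lambda>x. fixed_bound N x (Suc n)"] assms
    by (simp add: sum_distrib_left[symmetric])
  also have "\<dots> \<le> pochhammer (N + Suc n) k * (2 * pochhammer N (Suc n))"
    unfolding N_def by (intro mult_left_mono stirling_fixed_bound_sum_le \<open>0 < n\<close>) simp
  also have "\<dots> = 2 * pochhammer N r"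
    using pochhammer_product'[of N "Suc n" k] by (simp add: r mult_ac)
  also have "pochhammer N r = fact r * ((r + 2 ^ n - 1) choose r)"
    using pochhammer_eq_fact_binomial[of "N - 1" r] by (simp add: N_def)
  finally have "fact n * card B \<le> 2 * ((r + 2 ^ n - 1) choose r)"
    by simp
  then have "real (fact n * card B) \<le> real (2 * ((r + 2 ^ n - 1) choose r))"
    by (simp only: of_nat_le_iff)
  then show ?thesis by (simp add: field_simps)
qed

end
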